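(* Let $\mathcal{X},\mathcal{Y},\mathcal{I}$ be finite nonempty sets, let $C:\mathcal{X}\times\mathcal{Y}\to\mathbb{R}$ be a channel, let $\{C_i\}_{i\in\mathcal{I}}$ be a family of channels with $C_i=C$ for all $i\in\mathcal{I}$, and let $\mu$ be a probability distribution on $\mathcal{I}$. Then: (a) $\bigoplus_{i\leftarrow\mu}C_i=C$; and (b) $\bigsqcup_{i\leftarrow\mu}C_i\approx C$.
   Context: A channel is a matrix $C:\mathcal{X}\times\mathcal{Y}\to\mathbb{R}$ with nonnegative entries and $\sum_{y\in\mathcal{Y}}C(x,y)=1$ for all $x\in\mathcal{X}$; $\mathcal{X}$ is its input set and $\mathcal{Y}$ its output set. Channels are compatible if they have the same input set, and have the same type if they have the same input set and the same output set. Hidden choice (for channels of the same type): $\bigoplus_{i\leftarrow\mu}C_i=\sum_{i\in\mathcal{I}}\mu(i)C_i$. Visible choice (for compatible channels $C_i:\mathcal{X}\times\mathcal{Y}_i\to\mathbb{R}$): $\bigsqcup_{i\leftarrow\mu}C_i$ is the channel with input set $\mathcal{X}$ and output set the disjoint union $\{(y,i)\mid i\in\mathcal{I},y\in\mathcal{Y}_i\}$ given by $(x,(y,j))\mapsto\mu(j)C_j(x,y)$. $\mathbb{D}\mathcal{X}$ is the set of probability distributions on $\mathcal{X}$. A vulnerability is any continuous convex function $\mathbb{V}:\mathbb{D}\mathcal{X}\to\mathbb{R}$. For a prior $\pi\in\mathbb{D}\mathcal{X}$ and a channel $C:\mathcal{X}\times\mathcal{Y}\to\mathbb{R}$, put $p(y)=\sum_{x}\pi(x)C(x,y)$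 and, when $p(y)\ne0$, let $p_{X\mid y}\in\mathbb{D}\mathcal{X}$ be $x\mapsto\pi(x)C(x,y)/p(y)$. The posterior vulnerability is $\mathbb{V}[\pi,C]=\sum_{y\in\mathcal{Y},\,p(y)\neq0}p(y)\,\mathbb{V}(p_{X\mid y})$. Two compatible channels $C_1,C_2$ with input set $\mathcal{X}$ are equivalent, written $C_1\approx C_2$, if $\mathbb{V}[\pi,C_1]=\mathbb{V}[\pi,C_2]$ for every $\pi\in\mathbb{D}\mathcal{X}$ and every vulnerability $\mathbb{V}$. *)

theory Defs
  imports "HOL-Analysis.Analysis"
begin

text \<open>
  The input set is a finite type \<open>'x\<close>, so that distributions on it are vectors in \<open>real ^ 'x\<close> and
  continuity and convexity are the library's notions. Output sets and index sets are explicit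
  finite sets, since the members of a family of compatible channels may have different output sets.
  A channel with output set \<open>Y\<close> is a function \<open>C\<close> whose values \<open>C x y\<close> matter only for \<open>y \<in> Y\<close>;
  two such functions are the same channel if they agree there.
\<close>

text \<open>Finiteness and nonemptiness of \<open>Y\<close> follow from the sum being 1; likewise for
  \<open>prob_dist\<close>.\<close>

definition channel :: "'y set \<Rightarrow> ('x::finite \<Rightarrow> 'y \<Rightarrow> real) \<Rightarrow> bool" where
  "channel Y C \<longleftrightarrow> (\<forall>x. \<forall>y\<in>Y. 0 \<le> C x y) \<and> (\<forall>x. (\<Sum>y\<in>Y. C x y) = 1)"

definition prob_dist :: "'i set \<Rightarrow> ('i \<Rightarrow> real) \<Rightarrow> bool" where
  "prob_dist I \<mu> \<longleftrightarrow> (\<forall>i\<in>I. 0 \<le> \<mu> i) \<and> (\<Sum>i\<in>I. \<mu> i) = 1"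

definition hidden_choice ::
    "'i set \<Rightarrow> ('i \<Rightarrow> real) \<Rightarrow> ('i \<Rightarrow> 'x::finite \<Rightarrow> 'y \<Rightarrow> real) \<Rightarrow> 'x \<Rightarrow> 'y \<Rightarrow> real" where
  "hidden_choice I \<mu> C = (\<lambda>x y. \<Sum>i\<in>I. \<mu> i * C i x y)"

definition visible_outputs :: "'i set \<Rightarrow> ('i \<Rightarrow> 'y set) \<Rightarrow> ('y \<times> 'i) set" where
  "visible_outputs I Y = {(y, i). i \<in> I \<and> y \<in> Y i}"

text \<open>To be read on the output set \<open>visible_outputs I Y\<close>, where \<open>Y i\<close> is the output set of \<open>C i\<close>.\<close>

definition visible_choice ::
    "('i \<Rightarrow> real) \<Rightarrow> ('i \<Rightarrow> 'x::finite \<Rightarrow> 'y \<Rightarrow> real) \<Rightarrow> 'x \<Rightarrow> 'y \<times> 'i \<Rightarrow> real" where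
  "visible_choice \<mu> C = (\<lambda>x (y, j). \<mu> j * C j x y)"

definition distributions :: "(real ^ 'x::finite) set" where
  "distributions = {p. (\<forall>x. 0 \<le> p $ x) \<and> (\<Sum>x\<in>UNIV. p $ x) = 1}"

definition vulnerability :: "(real ^ 'x::finite \<Rightarrow> real) \<Rightarrow> bool" where
  "vulnerability V \<longleftrightarrow> continuous_on distributions V \<and> convex_on distributions V"

definition output_prob :: "real ^ 'x::finite \<Rightarrow> ('x \<Rightarrow> 'y \<Rightarrow> real) \<Rightarrow> 'y \<Rightarrow> real" where
  "output_prob \<pi> C y = (\<Sum>x\<in>UNIV. \<pi> $ x * C x y)"

definition posterior :: "real ^ 'x::finite \<Rightarrow> ('x \<Rightarrow> 'y \<Rightarrow> real) \<Rightarrow> 'y \<Rightarrow> real ^ 'x" where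
  "posterior \<pi> C y = (\<chi> x. \<pi> $ x * C x y / output_prob \<pi> C y)"

definition posterior_vulnerability ::
    "(real ^ 'x::finite \<Rightarrow> real) \<Rightarrow> real ^ 'x \<Rightarrow> 'y set \<Rightarrow> ('x \<Rightarrow> 'y \<Rightarrow> real) \<Rightarrow> real" where
  "posterior_vulnerability V \<pi> Y C =
     (\<Sum>y | y \<in> Y \<and> output_prob \<pi> C y \<noteq> 0. output_prob \<pi> C y * V (posterior \<pi> C y))"

definition channel_equiv ::
    "'y set \<Rightarrow> ('x::finite \<Rightarrow> 'y \<Rightarrow> real) \<Rightarrow> 'z set \<Rightarrow> ('x \<Rightarrow> 'z \<Rightarrow> real) \<Rightarrow> bool" where
  "channel_equiv Y C Z D \<longleftrightarrow>
     (\<forall>\<pi>\<in>distributions. \<forall>V. vulnerability V \<longrightarrow>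
        posterior_vulnerability V \<pi> Y C = posterior_vulnerability V \<pi> Z D)"

end

theory Submission
  imports Defs
begin

text \<open>
  The posterior vulnerability of a visible choice is the \<open>\<mu>\<close>-average of the posterior
  vulnerabilities of its members: scaling the column of an output by \<open>\<mu> j \<noteq> 0\<close> scales its
  probability and leaves its posterior unchanged. A constant family averages to the vulnerability
  of \<open>C\<close>.
\<close>

text \<open>The outputs of probability 0 can be included, since the junk value of \<open>V\<close> at their
  posterior is multiplied by 0.\<close>

lemma posterior_vulnerability_eq_sum:
  assumes "finite Y"
  shows "posterior_vulnerability V \<pi> Y C = (\<Sum>y\<in>Y. output_prob \<pi> C y * V (posterior \<pi> C y))"
  unfolding posterior_vulnerability_def
  by (rule sum.mono_neutral_left) (use assms in auto)

lemma output_prob_visible_choice: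
  "output_prob \<pi> (visible_choice \<mu> C) (y, j) = \<mu> j * output_prob \<pi> (C j) y"
  by (simp add: output_prob_def visible_choice_def sum_distrib_left mult_ac)

text \<open>The factor \<open>\<mu> j\<close> cancels between numerator and denominator. At
  \<open>\<mu> j = 0\<close> the left side is the zero vector, by division by 0.\<close>

lemma posterior_visible_choice:
  assumes "\<mu> j \<noteq> 0"
  shows "posterior \<pi> (visible_choice \<mu> C) (y, j) = posterior \<pi> (C j) y"
  using assms
  \<comment> \<open>\<open>visible_choice\<close> stays folded at first, so that
    \<open>output_prob_visible_choice\<close> can match.\<close>
  by (simp add: posterior_def output_prob_visible_choice vec_eq_iff)
    (simp add: visible_choice_def)

lemma posterior_vulnerability_visible_choice:
  assumes "finite I" and "\<And>i. i \<in> I \<Longrightarrow> finite (Y i)"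
  shows "posterior_vulnerability V \<pi> (visible_outputs I Y) (visible_choice \<mu> C) =
    (\<Sum>i\<in>I. \<mu> i * posterior_vulnerability V \<pi> (Y i) (C i))"
proof -
  let ?f = "\<lambda>z. output_prob \<pi> (visible_choice \<mu> C) z * V (posterior \<pi> (visible_choice \<mu> C) z)"
  \<comment> \<open>An output carries its index second, \<open>Sigma\<close> carries it first. The
    swap gives finiteness and the iterated sum with \<open>i\<close> outermost.\<close>
  have outputs: "visible_outputs I Y = prod.swap ` Sigma I Y"
    by (auto simp: visible_outputs_def)
  have "posterior_vulnerability V \<pi> (visible_outputs I Y) (visible_choice \<mu> C) =
      sum ?f (visible_outputs I Y)"
    using assms by (intro posterior_vulnerability_eq_sum) (auto simp: outputs)
  also have "\<dots> = (\<Sum>(i, y)\<in>Sigma I Y. ?f (y, i))"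
    unfolding outputs by (subst sum.reindex) (auto intro!: sum.cong)
  also have "\<dots> = (\<Sum>i\<in>I. \<Sum>y\<in>Y i. ?f (y, i))"
    using assms by (simp add: sum.Sigma)
  also have "\<dots> = (\<Sum>i\<in>I. \<mu> i * posterior_vulnerability V \<pi> (Y i) (C i))"
  proof (rule sum.cong[OF refl])
    fix i assume "i \<in> I"
    \<comment> \<open>If \<open>\<mu> i = 0\<close>, the two posteriors may differ, but both sides
      vanish.\<close>
    have "?f (y, i) = \<mu> i * (output_prob \<pi> (C i) y * V (posterior \<pi> (C i) y))" for y
      by (cases "\<mu> i = 0") (simp_all add: output_prob_visible_choice posterior_visible_choice)
    then show "(\<Sum>y\<in>Y i. ?f (y, i)) = \<mu> i * posterior_vulnerability V \<pi> (Y i) (C i)"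
      using assms(2)[OF \<open>i \<in> I\<close>] by (simp add: posterior_vulnerability_eq_sum sum_distrib_left)
  qed
  finally show ?thesis .
qed

text \<open>Equal channels may be different functions off the output set, so the members of a
  constant family cannot simply be rewritten to \<open>C\<close>.\<close>

lemma posterior_vulnerability_cong:
  assumes "\<And>x y. y \<in> Y \<Longrightarrow> C x y = D x y"
  shows "posterior_vulnerability V \<pi> Y C = posterior_vulnerability V \<pi> Y D"
proof -
  have "output_prob \<pi> C y = output_prob \<pi> D y" if "y \<in> Y" for y
    using assms that by (simp add: output_prob_def)
  moreover from this have "posterior \<pi> C y = posterior \<pi> D y" if "y \<in> Y" for y
    using assms that by (simp add: posterior_def)
  ultimately show ?thesis
    unfolding posterior_vulnerability_def by (intro sum.cong) auto
qed

theorem proposition5: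
  fixes Y :: "'y set" and I :: "'i set"
    and C :: "'x::finite \<Rightarrow> 'y \<Rightarrow> real"
    and Ys :: "'i \<Rightarrow> 'y set" and Cs :: "'i \<Rightarrow> 'x \<Rightarrow> 'y \<Rightarrow> real"
    and \<mu> :: "'i \<Rightarrow> real"
  assumes "finite Y" "Y \<noteq> {}" "finite I" "I \<noteq> {}"
    and "channel Y C"
    and "\<And>i. i \<in> I \<Longrightarrow> channel (Ys i) (Cs i)"
    and "\<And>i. i \<in> I \<Longrightarrow> Ys i = Y"
    and "\<And>i x y. i \<in> I \<Longrightarrow> y \<in> Y \<Longrightarrow> Cs i x y = C x y"
    and "prob_dist I \<mu>"
  shows "(\<forall>x. \<forall>y\<in>Y. hidden_choice I \<mu> Cs x y = C x y) \<and>
    channel_equiv (visible_outputs I Ys) (visible_choice \<mu> Cs) Y C"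
proof
  have sum_\<mu>: "sum \<mu> I = 1"
    using assms(9) by (simp add: prob_dist_def)
  \<comment> \<open>The common entry \<open>C x y\<close> factors out of the sum and leaves the
    total weight 1.\<close>
  show "\<forall>x. \<forall>y\<in>Y. hidden_choice I \<mu> Cs x y = C x y"
    using assms(8) sum_\<mu> by (simp add: hidden_choice_def flip: sum_distrib_right)
  have "posterior_vulnerability V \<pi> (visible_outputs I Ys) (visible_choice \<mu> Cs) =
      posterior_vulnerability V \<pi> Y C" for V \<pi>
  proof -
    have "posterior_vulnerability V \<pi> (visible_outputs I Ys) (visible_choice \<mu> Cs) =
        (\<Sum>i\<in>I. \<mu> i * posterior_vulnerability V \<pi> (Ys i) (Cs i))"
      using assms(1,3,7) by (simp add: posterior_vulnerability_visible_choice)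
    also have "\<dots> = (\<Sum>i\<in>I. \<mu> i * posterior_vulnerability V \<pi> Y C)"
    proof (rule sum.cong[OF refl])
      fix i assume "i \<in> I"
      then show "\<mu> i * posterior_vulnerability V \<pi> (Ys i) (Cs i) =
          \<mu> i * posterior_vulnerability V \<pi> Y C"
        using assms(7,8) posterior_vulnerability_cong[of Y "Cs i" C] by simp
    qed
    \<comment> \<open>The summand now depends on \<open>i\<close> only through its weight, and the
      weights add up to 1.\<close>
    also have "\<dots> = posterior_vulnerability V \<pi> Y C"
      using sum_\<mu> by (simp flip: sum_distrib_right)
    finally show ?thesis .
  qed
  then show "channel_equiv (visible_outputs I Ys) (visible_choice \<mu> Cs) Y C"
    by (simp add: channel_equiv_def)
qed

end
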